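(* Let $(A,d_A)$ be a differential algebra of weight $\lambda$, regarded as the regular bimodule over itself. If $\tilde H^2_{\mathsf{DA}_\lambda}(A,A)=0$, then the differential algebra $(A,d_A)$ is rigid.
   Context: Throughout, $\mathbf{k}$ is a field of characteristic zero; all vector spaces, algebras, linear maps and tensor products are over $\mathbf{k}$. Fix $\lambda\in\mathbf{k}$. A differential algebra of weight $\lambda$ is an associative algebra $A$ with a linear operator $d_A:A\to A$ such that $d_A(xy)=d_A(x)y+xd_A(y)+\lambda d_A(x)d_A(y)$ for all $x,y\in A$; if $A$ is unital one further requires $d_A(1_A)=0$. Let $\mu_A$ denote the multiplication of $A$. The regular bimodule is $A$ acting on itself by left and right multiplication, with operator $d_A$. A 1-parameter formal deformation of $(A,d_A)$ is a pair $\mu_t=\sum_{i\ge0}\mu_it^i$, $d_t=\sum_{i\ge0}d_it^i$ with $\mu_i\in\mathrm{Hom}(A\otimes A,A)$, $d_i\in\mathrm{Hom}(A,A)$, such that (extending $\mathbf{k}[[t]]$-linearly) $(A[[t]],\mu_t,d_t)$ is a differential algebra of weight $\lambda$ over $\mathbf{k}[[t]]$ and $(\mu_0,d_0)=(\mu_A,d_A)$. It is trivial if it is equivalent to $(A[[t]],\mu_A,d_A)$, i.e. there is a power series $\Phi_t=\sum_{i\ge0}\phi_it^i:A[[t]]\to A[[t]]$, with $\phi_i:A\to A$ linear and $\phi_0=\mathrm{Id}_A$, such that $\Phi_t\circ\mu_t=\mu_A\circ(\Phi_t\times\Phi_t)$ and $\Phi_t\circ d_t=d_A\circ\Phi_t$.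 $(A,d_A)$ is rigid if every 1-parameter formal deformation of it is trivial. $\tilde H^2_{\mathsf{DA}_\lambda}(A,A)$ is the space of 2-cocycles modulo 2-coboundaries. The 2-cocycles are the pairs $(f,g)\in\mathrm{Hom}(A^{\otimes2},A)\oplus\mathrm{Hom}(A,A)$ with $\partial f=0$ and $\partial_\lambda g+\delta f=0$, where $\partial f(x,y,z)=xf(y,z)-f(xy,z)+f(x,yz)-f(x,y)z$, $\ \partial_\lambda g(x,y)=(x+\lambda d_A(x))g(y)-g(xy)+g(x)(y+\lambda d_A(y))$, $\ \delta f(x,y)=f(d_A(x),y)+f(x,d_A(y))+\lambda f(d_A(x),d_A(y))-d_A(f(x,y))$. The 2-coboundaries are the pairs $(\partial\phi,-\delta\phi)$ for $\phi\in\mathrm{Hom}(A,A)$, where $\partial\phi(x,y)=x\phi(y)-\phi(xy)+\phi(x)y$ and $\delta\phi(x)=\phi(d_A(x))-d_A(\phi(x))$. *)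

theory Defs
  imports
    "HOL-Computational_Algebra.Formal_Power_Series"
    "HOL-Library.Product_Plus"
begin

unbundle fps_syntax

text \<open>
  Elements of \<open>Hom(A \<otimes> A, A)\<close> are represented by bilinear maps \<open>A \<times> A \<rightarrow> A\<close> in curried form.
\<close>

definition bilinear_map :: "('r::comm_ring_1 \<Rightarrow> 'a::ab_group_add \<Rightarrow> 'a) \<Rightarrow> ('a \<Rightarrow> 'a \<Rightarrow> 'a) \<Rightarrow> bool" where
  "bilinear_map scale f \<longleftrightarrow>
     (\<forall>x. module_hom scale scale (f x)) \<and> (\<forall>y. module_hom scale scale (\<lambda>x. f x y))"

text \<open>
  The ground ring is an arbitrary commutative ring, because the notion is needed both over the
  field \<open>k\<close> and over \<open>k[[t]]\<close>. Algebras need not be unital; the last axiom applies only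
  if a unit exists.
\<close>

locale differential_algebra = module scale
  for scale :: "'r::comm_ring_1 \<Rightarrow> 'a::ab_group_add \<Rightarrow> 'a" (infixr \<open>*s\<close> 75) +
  fixes mult :: "'a \<Rightarrow> 'a \<Rightarrow> 'a" (infixl \<open>\<cdot>\<close> 70)
    and d :: "'a \<Rightarrow> 'a"
    and weight :: 'r
  assumes mult_bilinear: "bilinear_map scale mult"
    and mult_assoc: "(x \<cdot> y) \<cdot> z = x \<cdot> (y \<cdot> z)"
    and d_linear: "module_hom scale scale d"
    and d_mult: "d (x \<cdot> y) = d x \<cdot> y + x \<cdot> d y + weight *s (d x \<cdot> d y)"
    and d_unit: "(\<And>x. e \<cdot> x = x \<and> x \<cdot> e = x) \<Longrightarrow> d e = 0"

text \<open>
  \<open>A[[t]]\<close> is the type \<open>'a fps\<close>. The following are its \<open>k[[t]]\<close>-module structure, and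
  the \<open>k[[t]]\<close>-(bi)linear extensions to \<open>A[[t]]\<close> of power series \<open>\<Sum>f\<^sub>i t\<^sup>i\<close> of
  (bi)linear maps on \<open>A\<close>, given by their coefficients \<open>f i\<close>.
\<close>

definition fps_scale :: "('r::comm_ring_1 \<Rightarrow> 'a::ab_group_add \<Rightarrow> 'a) \<Rightarrow> 'r fps \<Rightarrow> 'a fps \<Rightarrow> 'a fps" where
  "fps_scale scale c x = Abs_fps (\<lambda>n. \<Sum>i\<le>n. scale (c $ i) (x $ (n - i)))"

definition fps_ext :: "(nat \<Rightarrow> 'a::ab_group_add \<Rightarrow> 'a) \<Rightarrow> 'a fps \<Rightarrow> 'a fps" where
  "fps_ext f x = Abs_fps (\<lambda>n. \<Sum>i\<le>n. f i (x $ (n - i)))"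

definition fps_ext2 :: "(nat \<Rightarrow> 'a::ab_group_add \<Rightarrow> 'a \<Rightarrow> 'a) \<Rightarrow> 'a fps \<Rightarrow> 'a fps \<Rightarrow> 'a fps" where
  "fps_ext2 f x y = Abs_fps (\<lambda>n. \<Sum>i\<le>n. \<Sum>j\<le>n - i. f i (x $ j) (y $ (n - i - j)))"

definition const_series :: "('a::ab_group_add \<Rightarrow> 'a) \<Rightarrow> nat \<Rightarrow> 'a \<Rightarrow> 'a" where
  "const_series f i = (if i = 0 then f else (\<lambda>_. 0))"

definition const_series2 :: "('a::ab_group_add \<Rightarrow> 'a \<Rightarrow> 'a) \<Rightarrow> nat \<Rightarrow> 'a \<Rightarrow> 'a \<Rightarrow> 'a" where
  "const_series2 f i = (if i = 0 then f else (\<lambda>_ _. 0))"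

context differential_algebra
begin

definition formal_deformation :: "(nat \<Rightarrow> 'a \<Rightarrow> 'a \<Rightarrow> 'a) \<Rightarrow> (nat \<Rightarrow> 'a \<Rightarrow> 'a) \<Rightarrow> bool" where
  "formal_deformation \<mu> \<delta> \<longleftrightarrow>
     (\<forall>i. bilinear_map scale (\<mu> i)) \<and> (\<forall>i. module_hom scale scale (\<delta> i)) \<and>
     differential_algebra (fps_scale scale) (fps_ext2 \<mu>) (fps_ext \<delta>) (fps_const weight) \<and>
     \<mu> 0 = mult \<and> \<delta> 0 = d"

definition equivalent_deformations ::
    "(nat \<Rightarrow> 'a \<Rightarrow> 'a \<Rightarrow> 'a) \<Rightarrow> (nat \<Rightarrow> 'a \<Rightarrow> 'a) \<Rightarrow> (nat \<Rightarrow> 'a \<Rightarrow> 'a \<Rightarrow> 'a) \<Rightarrow> (nat \<Rightarrow> 'a \<Rightarrow> 'a) \<Rightarrow> bool" where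
  "equivalent_deformations \<mu> \<delta> \<mu>' \<delta>' \<longleftrightarrow>
     (\<exists>\<phi> :: nat \<Rightarrow> 'a \<Rightarrow> 'a. (\<forall>i. module_hom scale scale (\<phi> i)) \<and> \<phi> 0 = id \<and>
        (\<forall>x y. fps_ext \<phi> (fps_ext2 \<mu> x y) = fps_ext2 \<mu>' (fps_ext \<phi> x) (fps_ext \<phi> y)) \<and>
        (\<forall>x. fps_ext \<phi> (fps_ext \<delta> x) = fps_ext \<delta>' (fps_ext \<phi> x)))"

definition trivial_deformation :: "(nat \<Rightarrow> 'a \<Rightarrow> 'a \<Rightarrow> 'a) \<Rightarrow> (nat \<Rightarrow> 'a \<Rightarrow> 'a) \<Rightarrow> bool" where
  "trivial_deformation \<mu> \<delta> \<longleftrightarrow> equivalent_deformations \<mu> \<delta> (const_series2 mult) (const_series d)"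

definition rigid :: bool where
  "rigid \<longleftrightarrow> (\<forall>\<mu> \<delta>. formal_deformation \<mu> \<delta> \<longrightarrow> trivial_deformation \<mu> \<delta>)"

text \<open>
  The operators \<open>\<partial>\<close> (in degrees 1 and 2), \<open>\<partial>\<^sub>\<lambda>\<close> (in degree 1) and \<open>\<delta>\<close> (in degrees 1
  and 2) for the regular bimodule.
\<close>

definition hoch1 :: "('a \<Rightarrow> 'a) \<Rightarrow> 'a \<Rightarrow> 'a \<Rightarrow> 'a" where
  "hoch1 \<phi> x y = x \<cdot> \<phi> y - \<phi> (x \<cdot> y) + \<phi> x \<cdot> y"

definition hoch2 :: "('a \<Rightarrow> 'a \<Rightarrow> 'a) \<Rightarrow> 'a \<Rightarrow> 'a \<Rightarrow> 'a \<Rightarrow> 'a" where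
  "hoch2 f x y z = x \<cdot> f y z - f (x \<cdot> y) z + f x (y \<cdot> z) - f x y \<cdot> z"

definition hoch1_weighted :: "('a \<Rightarrow> 'a) \<Rightarrow> 'a \<Rightarrow> 'a \<Rightarrow> 'a" where
  "hoch1_weighted g x y =
     (x + weight *s d x) \<cdot> g y - g (x \<cdot> y) + g x \<cdot> (y + weight *s d y)"

definition delta1 :: "('a \<Rightarrow> 'a) \<Rightarrow> 'a \<Rightarrow> 'a" where
  "delta1 \<phi> x = \<phi> (d x) - d (\<phi> x)"

definition delta2 :: "('a \<Rightarrow> 'a \<Rightarrow> 'a) \<Rightarrow> 'a \<Rightarrow> 'a \<Rightarrow> 'a" where
  "delta2 f x y = f (d x) y + f x (d y) + weight *s f (d x) (d y) - d (f x y)"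

definition cocycles2 :: "(('a \<Rightarrow> 'a \<Rightarrow> 'a) \<times> ('a \<Rightarrow> 'a)) set" where
  "cocycles2 = {(f, g). bilinear_map scale f \<and> module_hom scale scale g \<and>
     (\<forall>x y z. hoch2 f x y z = 0) \<and> (\<forall>x y. hoch1_weighted g x y + delta2 f x y = 0)}"

definition coboundaries2 :: "(('a \<Rightarrow> 'a \<Rightarrow> 'a) \<times> ('a \<Rightarrow> 'a)) set" where
  "coboundaries2 = {(hoch1 \<phi>, \<lambda>x. - delta1 \<phi> x) | \<phi>. module_hom scale scale \<phi>}"

text \<open>
  The quotient space of cocycles modulo coboundaries, as a set of cosets; its zero element is the
  coset \<open>coboundaries2\<close>. The subtraction \<open>p - q\<close> is pointwise in both components.
\<close>

definition cohomology2 :: "(('a \<Rightarrow> 'a \<Rightarrow> 'a) \<times> ('a \<Rightarrow> 'a)) set set" where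
  "cohomology2 =
     cocycles2 // {(p, q). p \<in> cocycles2 \<and> q \<in> cocycles2 \<and> p - q \<in> coboundaries2}"

end

end

(* The comparison map between a deformation and the undeformed algebra is built one coefficient at
   a time. Suppose a series Phi with phi_0 = id intertwines the two structures modulo t^n. Comparing
   the t^n-coefficients in the associativity and derivation identities shows that the t^n-coefficient
   of the failure of Phi to intertwine is a 2-cocycle. It is then the coboundary of some psi, and
   adding psi to phi_n makes Phi intertwine modulo t^(n+1). *)

theory Submission
  imports Defs
begin

section \<open>Coefficients and composition of series of maps\<close>

lemma module_hom_additive: "module_hom s1 s2 f \<Longrightarrow> additive f"
  by (simp add: additive_def module_hom.add)

lemma fps_ext_nth: "fps_ext f x $ n = (\<Sum>i\<le>n. f i (x $ (n - i)))"
  by (simp add: fps_ext_def)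

lemma fps_ext2_nth: "fps_ext2 f x y $ n = (\<Sum>i\<le>n. \<Sum>j\<le>n - i. f i (x $ j) (y $ (n - i - j)))"
  by (simp add: fps_ext2_def)

lemma fps_ext_const_series_nth: "fps_ext (const_series f) x $ n = f (x $ n)"
proof -
  have "const_series f i (x $ (n - i)) = (if i = 0 then f (x $ n) else 0)" for i
    by (simp add: const_series_def)
  then show ?thesis
    by (simp add: fps_ext_nth)
qed

lemma fps_ext2_const_series2_nth:
  "fps_ext2 (const_series2 f) x y $ n = (\<Sum>j\<le>n. f (x $ j) (y $ (n - j)))"
proof -
  have "(\<Sum>j\<le>n - i. const_series2 f i (x $ j) (y $ (n - i - j)))
      = (if i = 0 then \<Sum>j\<le>n. f (x $ j) (y $ (n - j)) else 0)" for i
    by (simp add: const_series2_def)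
  then show ?thesis
    by (simp add: fps_ext2_nth)
qed

lemma additive_fps_ext: "(\<And>i. additive (f i)) \<Longrightarrow> additive (fps_ext f)"
  by (simp add: additive_def fps_eq_iff fps_ext_nth sum.distrib)

lemma additive_fps_ext2_right:
  "(\<And>i a. additive (f i a)) \<Longrightarrow> additive (fps_ext2 f x)"
  by (simp add: additive_def fps_eq_iff fps_ext2_nth sum.distrib)

lemma additive_fps_ext2_left:
  "(\<And>i b. additive (\<lambda>a. f i a b)) \<Longrightarrow> additive (\<lambda>x. fps_ext2 f x y)"
  by (simp add: additive_def fps_eq_iff fps_ext2_nth sum.distrib)

text \<open>Both sides run once over the triples of naturals with total \<open>n\<close>; this is
  the reindexing behind associativity of the Cauchy product.\<close>

lemma sum_triple_assoc:
  fixes f :: "nat \<Rightarrow> nat \<Rightarrow> nat \<Rightarrow> 'a::comm_monoid_add"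
  shows "(\<Sum>j\<le>n. \<Sum>i\<le>j. f i (j - i) (n - j)) = (\<Sum>j\<le>n. \<Sum>i\<le>n - j. f j i (n - j - i))"
  using fps_mult_assoc_lemma[of f n n] by (simp add: atLeast0AtMost)

text \<open>Additivity moves \<open>f\<close> inside the inner coefficient sum; regrouping the index
  triples by the joint degree of \<open>f\<close> and \<open>g\<close> then produces the
  convolution. The binary version below works the same way.\<close>

lemma fps_ext_fps_ext:
  assumes "\<And>i. additive (f i)"
  shows "fps_ext f (fps_ext g x) = fps_ext (\<lambda>i a. \<Sum>j\<le>i. f j (g (i - j) a)) x"
  using assms
  by (simp add: fps_eq_iff fps_ext_nth additive.sum sum_triple_assoc[of "\<lambda>j i p. f j (g i (x $ p))" for x])

lemma fps_ext_fps_ext2: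
  assumes "\<And>i. additive (f i)"
  shows "fps_ext f (fps_ext2 g x y) = fps_ext2 (\<lambda>i a b. \<Sum>j\<le>i. f j (g (i - j) a b)) x y"
proof (rule fps_ext)
  fix n
  have "fps_ext f (fps_ext2 g x y) $ n
      = (\<Sum>j\<le>n. \<Sum>i\<le>n - j. \<Sum>k\<le>n - j - i. f j (g i (x $ k) (y $ (n - j - i - k))))"
    using assms by (simp add: fps_ext_nth fps_ext2_nth additive.sum)
  also have "\<dots> = (\<Sum>m\<le>n. \<Sum>j\<le>m. \<Sum>k\<le>n - m. f j (g (m - j) (x $ k) (y $ (n - m - k))))"
    by (rule sum_triple_assoc[symmetric, of "\<lambda>j i p. \<Sum>k\<le>p. f j (g i (x $ k) (y $ (p - k)))"])
  also have "\<dots> = (\<Sum>m\<le>n. \<Sum>k\<le>n - m. \<Sum>j\<le>m. f j (g (m - j) (x $ k) (y $ (n - m - k))))"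
    by (intro sum.cong sum.swap refl)
  finally show "fps_ext f (fps_ext2 g x y) $ n
      = fps_ext2 (\<lambda>i a b. \<Sum>j\<le>i. f j (g (i - j) a b)) x y $ n"
    by (simp add: fps_ext2_nth)
qed

lemma fps_ext2_const_series2_fps_ext:
  assumes "\<And>a. additive (f a)" "\<And>b. additive (\<lambda>a. f a b)"
  shows "fps_ext2 (const_series2 f) (fps_ext g x) (fps_ext h y)
    = fps_ext2 (\<lambda>i a b. \<Sum>j\<le>i. f (g j a) (h (i - j) b)) x y"
proof (rule fps_ext)
  fix n
  have "fps_ext2 (const_series2 f) (fps_ext g x) (fps_ext h y) $ n
      = (\<Sum>p\<le>n. \<Sum>i\<le>p. \<Sum>j\<le>n - p. f (g i (x $ (p - i))) (h j (y $ (n - p - j))))"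
    by (simp add: fps_ext2_const_series2_nth fps_ext_nth additive.sum[OF assms(1)]
        additive.sum[OF assms(2)] sum.swap[of _ "{..n - p}" "{..p}" for p])
  also have "\<dots> = (\<Sum>(p, i, j)\<in>(SIGMA p:{..n}. {..p} \<times> {..n - p}).
      f (g i (x $ (p - i))) (h j (y $ (n - p - j))))"
    by (simp add: sum.Sigma sum.cartesian_product)
  \<comment> \<open>Four degrees with total \<open>n\<close> are regrouped: \<open>i\<close> for
    \<open>g\<close>, \<open>j\<close> for \<open>h\<close>, \<open>p - i\<close> for
    \<open>x\<close>, and the rest for \<open>y\<close>. The new indices are
    \<open>m = i + j\<close>, the joint degree of the maps, then the degree \<open>p - i\<close> of
    \<open>x\<close>, then the degree \<open>i\<close> of \<open>g\<close>.\<close>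
  also have "\<dots> = (\<Sum>(m, k, j)\<in>(SIGMA m:{..n}. {..n - m} \<times> {..m}).
      f (g j (x $ k)) (h (m - j) (y $ (n - m - k))))"
    by (rule sum.reindex_bij_witness[where
          i = "\<lambda>(m, k, j). (k + j, j, m - j)" and j = "\<lambda>(p, i, j). (i + j, p - i, i)"])
       (auto simp: algebra_simps)
  also have "\<dots> = (\<Sum>m\<le>n. \<Sum>k\<le>n - m. \<Sum>j\<le>m. f (g j (x $ k)) (h (m - j) (y $ (n - m - k))))"
    by (simp add: sum.Sigma sum.cartesian_product)
  finally show "fps_ext2 (const_series2 f) (fps_ext g x) (fps_ext h y) $ n
      = fps_ext2 (\<lambda>i a b. \<Sum>j\<le>i. f (g j a) (h (i - j) b)) x y $ n"
    by (simp add: fps_ext2_nth)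
qed

lemma fps_ext_diff: "fps_ext f x - fps_ext g x = fps_ext (\<lambda>i a. f i a - g i a) x"
  by (simp add: fps_eq_iff fps_ext_nth sum_subtractf)

lemma fps_ext2_diff: "fps_ext2 f x y - fps_ext2 g x y = fps_ext2 (\<lambda>i a b. f i a b - g i a b) x y"
  by (simp add: fps_eq_iff fps_ext2_nth sum_subtractf)

text \<open>If the maps start in degree \<open>n\<close>, the coefficient of \<open>t^n\<close>
  leaves degree 0 for the argument. This is how identities over \<open>A[[t]]\<close> descend to
  identities over \<open>A\<close>.\<close>

lemma fps_ext_nth_lowest:
  assumes "\<And>i a. i < n \<Longrightarrow> f i a = 0"
  shows "k < n \<Longrightarrow> fps_ext f x $ k = 0" and "fps_ext f x $ n = f n (x $ 0)"
proof -
  show "k < n \<Longrightarrow> fps_ext f x $ k = 0"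
    using assms by (simp add: fps_ext_nth)
  show "fps_ext f x $ n = f n (x $ 0)"
    unfolding fps_ext_nth
    by (subst sum.remove[where x = n]) (auto simp: assms intro!: sum.neutral)
qed

lemma fps_ext2_nth_lowest:
  assumes "\<And>i a b. i < n \<Longrightarrow> f i a b = 0"
  shows "k < n \<Longrightarrow> fps_ext2 f x y $ k = 0" and "fps_ext2 f x y $ n = f n (x $ 0) (y $ 0)"
proof -
  show "k < n \<Longrightarrow> fps_ext2 f x y $ k = 0"
    using assms by (simp add: fps_ext2_nth)
  show "fps_ext2 f x y $ n = f n (x $ 0) (y $ 0)"
    unfolding fps_ext2_nth
    by (subst sum.remove[where x = n]) (auto simp: assms intro!: sum.neutral)
qed

lemma (in module) fps_scale_const_nth: "fps_scale scale (fps_const c) x $ n = scale c (x $ n)"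
proof -
  have "scale (fps_const c $ i) (x $ (n - i)) = (if i = 0 then scale c (x $ n) else 0)" for i
    by simp
  then show ?thesis
    by (simp add: fps_scale_def)
qed

section \<open>The undeformed structure on \<open>A[[t]]\<close>\<close>

context differential_algebra
begin

interpretation self: module_pair scale scale ..

abbreviation fps_prod :: "'a fps \<Rightarrow> 'a fps \<Rightarrow> 'a fps" where
  "fps_prod \<equiv> fps_ext2 (const_series2 mult)"

abbreviation fps_d :: "'a fps \<Rightarrow> 'a fps" where
  "fps_d \<equiv> fps_ext (const_series d)"

abbreviation fps_weight :: "'a fps \<Rightarrow> 'a fps" where
  "fps_weight \<equiv> fps_scale scale (fps_const weight)"

lemma module_hom_mult: "module_hom scale scale (mult x)" "module_hom scale scale (\<lambda>x. x \<cdot> y)"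
  using mult_bilinear by (simp_all add: bilinear_map_def)

lemmas additive_mult = module_hom_mult[THEN module_hom_additive]
lemmas additive_d = d_linear[THEN module_hom_additive]

lemma additive_fps_prod: "additive (fps_prod x)" "additive (\<lambda>x. fps_prod x y)"
proof -
  have "additive (const_series2 mult i a)" "additive (\<lambda>a. const_series2 mult i a b)" for i a b
    using additive_mult by (simp_all add: const_series2_def additive_def)
  then show "additive (fps_prod x)" "additive (\<lambda>x. fps_prod x y)"
    by (auto intro: additive_fps_ext2_right additive_fps_ext2_left)
qed

lemma additive_fps_d: "additive fps_d"
  using additive_d by (intro additive_fps_ext) (simp add: const_series_def additive_def)

lemma additive_fps_weight: "additive fps_weight"
  by (simp add: additive_def fps_eq_iff fps_scale_const_nth scale_right_distrib)

lemma fps_prod_assoc: "fps_prod (fps_prod x y) z = fps_prod x (fps_prod y z)"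
  by (simp add: fps_eq_iff fps_ext2_const_series2_nth mult_assoc
      additive.sum[OF additive_mult(1)] additive.sum[OF additive_mult(2)]
      sum_triple_assoc[of "\<lambda>i j k. x $ i \<cdot> (y $ j \<cdot> z $ k)"])

lemma fps_d_prod:
  "fps_d (fps_prod x y)
    = fps_prod (fps_d x) y + fps_prod x (fps_d y) + fps_weight (fps_prod (fps_d x) (fps_d y))"
  by (simp add: additive.sum[OF additive_d] fps_eq_iff fps_ext2_const_series2_nth fps_ext_const_series_nth fps_scale_const_nth
      d_mult sum.distrib scale_sum_right)

text \<open>Every other summand of the Cauchy product at \<open>t^n\<close> contains a coefficient
  of \<open>x\<close> below \<open>n\<close>.\<close>

lemma fps_prod_nth_lowest_left:
  assumes "\<And>k. k < n \<Longrightarrow> x $ k = 0"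
  shows "fps_prod x y $ n = x $ n \<cdot> y $ 0"
  unfolding fps_ext2_const_series2_nth
  by (subst sum.remove[where x = n])
     (auto simp: assms additive.zero[OF additive_mult(2)] intro!: sum.neutral)

lemma fps_prod_nth_lowest_right:
  assumes "\<And>k. k < n \<Longrightarrow> y $ k = 0"
  shows "fps_prod x y $ n = x $ 0 \<cdot> y $ n"
  unfolding fps_ext2_const_series2_nth
  by (subst sum.remove[where x = 0])
     (auto simp: assms additive.zero[OF additive_mult(1)] intro!: sum.neutral)

section \<open>Defects of a candidate equivalence\<close>

definition mult_defect ::
    "(nat \<Rightarrow> 'a \<Rightarrow> 'a \<Rightarrow> 'a) \<Rightarrow> (nat \<Rightarrow> 'a \<Rightarrow> 'a) \<Rightarrow> nat \<Rightarrow> 'a \<Rightarrow> 'a \<Rightarrow> 'a" where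
  "mult_defect \<mu> \<phi> i x y = (\<Sum>j\<le>i. \<phi> j (\<mu> (i - j) x y)) - (\<Sum>j\<le>i. \<phi> j x \<cdot> \<phi> (i - j) y)"

text \<open>The subtracted term is a single summand because the target operator \<open>d\<close> is
  constant in \<open>t\<close>.\<close>

definition d_defect :: "(nat \<Rightarrow> 'a \<Rightarrow> 'a) \<Rightarrow> (nat \<Rightarrow> 'a \<Rightarrow> 'a) \<Rightarrow> nat \<Rightarrow> 'a \<Rightarrow> 'a" where
  "d_defect \<delta> \<phi> i x = (\<Sum>j\<le>i. \<phi> j (\<delta> (i - j) x)) - d (\<phi> i x)"

text \<open>The composition formulas turn both ways around the square into extensions of series of
  maps, whose difference is formed coefficientwise. Vanishing of all defects, a condition on maps of
  \<open>A\<close>, thus makes the extended \<open>\<phi>\<close> multiplicative.\<close>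

lemma fps_ext_mult_defect:
  assumes "\<And>i. module_hom scale scale (\<phi> i)"
  shows "fps_ext \<phi> (fps_ext2 \<mu> x y)
    = fps_ext2 (mult_defect \<mu> \<phi>) x y + fps_prod (fps_ext \<phi> x) (fps_ext \<phi> y)"
  unfolding fps_ext_fps_ext2[of \<phi>, OF module_hom_additive, OF assms]
    fps_ext2_const_series2_fps_ext[of mult, OF additive_mult] mult_defect_def[abs_def]
    fps_ext2_diff[symmetric]
  by simp

lemma fps_ext_d_defect:
  assumes "\<And>i. module_hom scale scale (\<phi> i)"
  shows "fps_ext \<phi> (fps_ext \<delta> x) = fps_ext (d_defect \<delta> \<phi>) x + fps_d (fps_ext \<phi> x)"
proof -
  have "fps_d (fps_ext \<phi> x) = fps_ext (\<lambda>i a. d (\<phi> i a)) x"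
    by (simp add: fps_eq_iff fps_ext_const_series_nth fps_ext_nth[of \<phi>]
        fps_ext_nth[of "\<lambda>i a. d (\<phi> i a)"] additive.sum[OF additive_d])
  then show ?thesis
    unfolding fps_ext_fps_ext[of \<phi>, OF module_hom_additive, OF assms] d_defect_def[abs_def]
      fps_ext_diff[symmetric]
    by simp
qed

lemma bilinear_map_mult_defect:
  assumes "\<And>i. bilinear_map scale (\<mu> i)" "\<And>i. module_hom scale scale (\<phi> i)"
  shows "bilinear_map scale (mult_defect \<mu> \<phi> n)"
proof -
  have \<mu>: "module_hom scale scale (\<mu> i x)" "module_hom scale scale (\<lambda>x. \<mu> i x y)" for i x y
    using assms(1) by (simp_all add: bilinear_map_def)
  note comp = module_hom_compose[OF \<mu>(1) assms(2)] module_hom_compose[OF \<mu>(2) assms(2)]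
    module_hom_compose[OF assms(2) module_hom_mult(1)]
    module_hom_compose[OF assms(2) module_hom_mult(2)]
  have "module_hom scale scale (mult_defect \<mu> \<phi> n x)"
    and "module_hom scale scale (\<lambda>x. mult_defect \<mu> \<phi> n x y)" for x y
    unfolding mult_defect_def using module_axioms
    by (auto intro!: self.module_hom_sub self.module_hom_sum comp[unfolded o_def])
  then show ?thesis
    by (simp add: bilinear_map_def)
qed

lemma module_hom_d_defect:
  assumes "\<And>i. module_hom scale scale (\<delta> i)" "\<And>i. module_hom scale scale (\<phi> i)"
  shows "module_hom scale scale (d_defect \<delta> \<phi> n)"
  unfolding d_defect_def[abs_def]
  using assms d_linear module_axioms
  by (auto intro!: self.module_hom_sub self.module_hom_sum
      intro: module_hom_compose[unfolded o_def, where g = "\<phi> i" for i]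
        module_hom_compose[unfolded o_def, where g = d])

section \<open>The lowest defect as a 2-cocycle\<close>

lemma defect_mem_cocycles2:
  assumes deformation: "formal_deformation \<mu> \<delta>"
    and hom: "\<And>i. module_hom scale scale (\<phi> i)" and \<phi>0: "\<phi> 0 = id" and "n > 0"
    and low1: "\<And>i x y. i < n \<Longrightarrow> mult_defect \<mu> \<phi> i x y = 0"
    and low2: "\<And>i x. i < n \<Longrightarrow> d_defect \<delta> \<phi> i x = 0"
  shows "(mult_defect \<mu> \<phi> n, d_defect \<delta> \<phi> n) \<in> cocycles2"
proof -
  define e g where "e = mult_defect \<mu> \<phi> n" and "g = d_defect \<delta> \<phi> n"
  define \<Phi> M D where "\<Phi> = fps_ext \<phi>" and "M = fps_ext2 \<mu>" and "D = fps_ext \<delta>"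
  \<comment> \<open>\<open>E\<close> and \<open>G\<close> are the error terms by which
    \<open>\<Phi>\<close> fails to be a morphism into the undeformed algebra.\<close>
  define E G where "E = fps_ext2 (mult_defect \<mu> \<phi>)" and "G = fps_ext (d_defect \<delta> \<phi>)"
  interpret deformed: differential_algebra "fps_scale scale" M D "fps_const weight"
    using deformation by (simp add: formal_deformation_def M_def D_def)
  have \<mu>0: "\<mu> 0 = mult" and \<delta>0: "\<delta> 0 = d"
    using deformation by (simp_all add: formal_deformation_def)
  have \<Phi>M: "\<Phi> (M x y) = E x y + fps_prod (\<Phi> x) (\<Phi> y)" for x y
    unfolding \<Phi>_def M_def E_def by (rule fps_ext_mult_defect[OF hom])
  have \<Phi>D: "\<Phi> (D x) = G x + fps_d (\<Phi> x)" for x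
    unfolding \<Phi>_def D_def G_def by (rule fps_ext_d_defect[OF hom])
  have add\<Phi>: "additive \<Phi>"
    unfolding \<Phi>_def using hom by (intro additive_fps_ext module_hom_additive)
  have \<Phi>_weight: "\<Phi> (fps_weight x) = fps_weight (\<Phi> x)" for x
    by (simp add: \<Phi>_def fps_eq_iff fps_ext_nth fps_scale_const_nth module_hom.scale[OF hom]
        scale_sum_right)
  note adds = additive.add[OF additive_fps_prod(1)] additive.add[OF additive_fps_prod(2)]
    additive.add[OF additive_fps_d] additive.add[OF additive_fps_weight] additive.add[OF add\<Phi>]

  have E_low: "k < n \<Longrightarrow> E x y $ k = 0" and E_n: "E x y $ n = e (x $ 0) (y $ 0)" for k x y
    unfolding E_def e_def using low1 by (simp_all add: fps_ext2_nth_lowest)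
  have G_low: "k < n \<Longrightarrow> G x $ k = 0" and G_n: "G x $ n = g (x $ 0)" for k x
    unfolding G_def g_def using low2 by (simp_all add: fps_ext_nth_lowest)
  \<comment> \<open>Since \<open>n > 0\<close>, \<open>G\<close> has no constant term; this later
    removes the quadratic term \<open>fps_prod (G x) (G y)\<close> at \<open>t^n\<close>.\<close>
  have nth_0: "\<Phi> x $ 0 = x $ 0" "M x y $ 0 = x $ 0 \<cdot> y $ 0" "D x $ 0 = d (x $ 0)"
    "fps_d x $ 0 = d (x $ 0)" "G x $ 0 = 0" for x y
    using \<phi>0 \<mu>0 \<delta>0 G_low \<open>n > 0\<close>
    by (simp_all add: \<Phi>_def M_def D_def fps_ext_nth fps_ext2_nth const_series_def)
  note nth_n = E_n G_n nth_0 fps_ext_const_series_nth fps_scale_const_nth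
    fps_prod_nth_lowest_left[OF E_low] fps_prod_nth_lowest_right[OF E_low]
    fps_prod_nth_lowest_left[OF G_low] fps_prod_nth_lowest_right[OF G_low]

  \<comment> \<open>Apply \<open>\<Phi>\<close> to associativity of \<open>M\<close> and expand with
    \<open>\<Phi>M\<close>; the triple products of \<open>\<Phi> x\<close>, \<open>\<Phi> y\<close>,
    \<open>\<Phi> z\<close> cancel by \<open>fps_prod_assoc\<close>.\<close>
  have assoc: "E (M x y) z + fps_prod (E x y) (\<Phi> z) = E x (M y z) + fps_prod (\<Phi> x) (E y z)"
    for x y z
    using arg_cong[OF deformed.mult_assoc[of x y z], of \<Phi>]
    by (simp add: \<Phi>M adds fps_prod_assoc algebra_simps)
  \<comment> \<open>At \<open>t^n\<close> the error term uses up the whole degree, so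
    \<open>M\<close> and \<open>\<Phi>\<close> contribute only their degree 0 parts,
    \<open>mult\<close> and the identity.\<close>
  have "hoch2 e a b c = 0" for a b c
    using arg_cong[OF assoc[of "fps_const a" "fps_const b" "fps_const c"], of "\<lambda>x. x $ n"]
    by (simp add: nth_n hoch2_def algebra_simps)
  moreover
  \<comment> \<open>The same with the derivation law: the terms free of \<open>E\<close> and
    \<open>G\<close> cancel by \<open>fps_d_prod\<close>, and the weight passes through
    \<open>\<Phi>\<close> because each \<open>\<phi> i\<close> is linear.\<close>
  have deriv: "G (M x y) + fps_d (E x y)
      = E (D x) y + E x (D y) + fps_prod (G x) (\<Phi> y) + fps_prod (\<Phi> x) (G y)
        + fps_weight (E (D x) (D y) + fps_prod (G x) (fps_d (\<Phi> y))
            + fps_prod (fps_d (\<Phi> x)) (G y) + fps_prod (G x) (G y))" for x y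
    using arg_cong[OF deformed.d_mult[of x y], of \<Phi>]
    by (simp add: \<Phi>M \<Phi>D \<Phi>_weight adds fps_d_prod algebra_simps)
  have "hoch1_weighted g a b + delta2 e a b = 0" for a b
    using arg_cong[OF deriv[of "fps_const a" "fps_const b"], of "\<lambda>x. x $ n"]
    by (simp add: nth_n hoch1_weighted_def delta2_def
        additive.zero[OF additive_mult(1)] additive.zero[OF additive_mult(2)] additive.add[OF additive_mult(1)]
        additive.add[OF additive_mult(2)] module_hom.scale[OF module_hom_mult(1)]
        module_hom.scale[OF module_hom_mult(2)] algebra_simps)
  moreover have "bilinear_map scale e" "module_hom scale scale g"
    using deformation hom unfolding e_def g_def formal_deformation_def
    by (simp_all add: bilinear_map_mult_defect module_hom_d_defect)
  ultimately show ?thesis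
    by (simp add: cocycles2_def flip: e_def g_def)
qed

section \<open>Correcting one coefficient and assembling the equivalence\<close>

lemma defect_cong:
  assumes "\<And>j. j \<le> i \<Longrightarrow> \<phi> j = \<phi>' j"
  shows "mult_defect \<mu> \<phi> i = mult_defect \<mu> \<phi>' i" "d_defect \<delta> \<phi> i = d_defect \<delta> \<phi>' i"
  using assms by (simp_all add: mult_defect_def[abs_def] d_defect_def[abs_def])

text \<open>Only summands containing coefficient \<open>n\<close> of \<open>\<phi>\<close> change.
  In the composites this is \<open>j = n\<close>, paired with \<open>mult\<close> or
  \<open>d\<close>; in the product sum it is \<open>j = 0\<close> and \<open>j = n\<close>, distinct
  as \<open>n > 0\<close>, where the other factor is the identity. The two changes have exactly the
  signs of a 2-coboundary.\<close>

lemma defect_update: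
  assumes \<mu>0: "\<mu> 0 = mult" and \<delta>0: "\<delta> 0 = d" and \<phi>0: "\<phi> 0 = id" and "n > 0"
    and \<phi>': "\<phi>' = \<phi>(n := \<lambda>x. \<phi> n x + \<psi> x)"
  shows "mult_defect \<mu> \<phi>' n x y = mult_defect \<mu> \<phi> n x y - hoch1 \<psi> x y"
    and "d_defect \<delta> \<phi>' n x = d_defect \<delta> \<phi> n x + delta1 \<psi> x"
proof -
  have top: "{..n} = insert n {..<n}" and ends: "{..n} = insert 0 (insert n {0<..<n})"
    using \<open>n > 0\<close> by auto
  have \<phi>'_n: "\<phi>' n z = \<phi> n z + \<psi> z" and \<phi>'_0: "\<phi>' 0 z = z" for z
    using \<phi>0 \<open>n > 0\<close> by (simp_all add: \<phi>')
  have "(\<Sum>j<n. \<phi>' j (f j)) = (\<Sum>j<n. \<phi> j (f j))" for f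
    by (intro sum.cong) (auto simp: \<phi>')
  then have top_sum: "(\<Sum>j\<le>n. \<phi>' j (f j)) = (\<Sum>j\<le>n. \<phi> j (f j)) + \<psi> (f n)" for f
    unfolding top by (simp add: \<phi>'_n add_ac)
  have mid: "(\<Sum>j\<in>{0<..<n}. \<phi>' j x \<cdot> \<phi>' (n - j) y) = (\<Sum>j\<in>{0<..<n}. \<phi> j x \<cdot> \<phi> (n - j) y)"
    by (intro sum.cong) (auto simp: \<phi>')
  have "(\<Sum>j\<le>n. \<phi>' j x \<cdot> \<phi>' (n - j) y) = (\<Sum>j\<le>n. \<phi> j x \<cdot> \<phi> (n - j) y) + x \<cdot> \<psi> y + \<psi> x \<cdot> y"
    unfolding ends using \<open>n > 0\<close>
    by (simp add: mid \<phi>'_n \<phi>'_0 \<phi>0 additive.add[OF additive_mult(1)]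
        additive.add[OF additive_mult(2)] add_ac)
  then show "mult_defect \<mu> \<phi>' n x y = mult_defect \<mu> \<phi> n x y - hoch1 \<psi> x y"
    by (simp add: mult_defect_def hoch1_def top_sum \<mu>0)
  show "d_defect \<delta> \<phi>' n x = d_defect \<delta> \<phi> n x + delta1 \<psi> x"
    by (simp add: d_defect_def delta1_def top_sum \<delta>0 \<phi>'_n additive.add[OF additive_d])
qed

text \<open>A cocycle lies in its own class, since the zero pair is the coboundary of the zero map,
  and by assumption the only class is \<open>coboundaries2\<close>.\<close>

lemma cocycles2_subset_coboundaries2:
  assumes "cohomology2 = {coboundaries2}"
  shows "cocycles2 \<subseteq> coboundaries2"
proof
  fix p
  assume p: "p \<in> cocycles2"
  define r where "r = {(p, q). p \<in> cocycles2 \<and> q \<in> cocycles2 \<and> p - q \<in> coboundaries2}"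
  have "p - p = (hoch1 (\<lambda>_. 0), \<lambda>x. - delta1 (\<lambda>_. 0) x)"
    using additive.zero[OF additive_mult(1)] additive.zero[OF additive_mult(2)]
      additive.zero[OF additive_d]
    by (auto simp: prod_eq_iff hoch1_def delta1_def fun_eq_iff)
  then have "p - p \<in> coboundaries2"
    unfolding coboundaries2_def using self.module_hom_zero by blast
  then have "p \<in> r `` {p}"
    using p by (simp add: r_def)
  moreover have "r `` {p} \<in> cohomology2"
    unfolding cohomology2_def r_def using p by (rule quotientI)
  ultimately show "p \<in> coboundaries2"
    using assms by auto
qed

theorem rigid_if_cohomology2_trivial:
  assumes trivial: "cohomology2 = {coboundaries2}"
  shows rigid
  unfolding rigid_def
proof (intro allI impI)
  fix \<mu> \<delta>
  assume deformation: "formal_deformation \<mu> \<delta>"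
  then have \<mu>0: "\<mu> 0 = mult" and \<delta>0: "\<delta> 0 = d"
    by (simp_all add: formal_deformation_def)
  \<comment> \<open>The bound \<open>i\<le>n\<close> is inclusive: \<open>P n\<close> means
    intertwining modulo \<open>t^(n+1)\<close>. The base case is then the identity map, by
    \<open>\<mu>0\<close> and \<open>\<delta>0\<close>.\<close>
  define P where "P n \<phi> \<longleftrightarrow> (\<forall>i. module_hom scale scale (\<phi> i)) \<and> \<phi> 0 = id \<and>
    (\<forall>i\<le>n. (\<forall>x y. mult_defect \<mu> \<phi> i x y = 0) \<and> (\<forall>x. d_defect \<delta> \<phi> i x = 0))" for n \<phi>
  have "P 0 (\<lambda>i. if i = 0 then id else (\<lambda>_. 0))"
    using \<mu>0 \<delta>0 by (auto simp: P_def mult_defect_def d_defect_def module_hom_id self.module_hom_zero)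
  then have base: "\<exists>\<phi>. P 0 \<phi>" by (rule exI[of "P 0"])
  \<comment> \<open>Keeping all coefficients up to \<open>n\<close> is what allows a limit of the
    successive approximations.\<close>
  have step: "\<exists>\<phi>'. P (Suc n) \<phi>' \<and> (\<forall>i\<le>n. \<phi>' i = \<phi> i)" if "P n \<phi>" for n \<phi>
  proof -
    have hom: "\<And>i. module_hom scale scale (\<phi> i)" and \<phi>0: "\<phi> 0 = id"
      and low: "\<And>i x y. i < Suc n \<Longrightarrow> mult_defect \<mu> \<phi> i x y = 0"
        "\<And>i x. i < Suc n \<Longrightarrow> d_defect \<delta> \<phi> i x = 0"
      using that by (auto simp: P_def)
    have "(mult_defect \<mu> \<phi> (Suc n), d_defect \<delta> \<phi> (Suc n)) \<in> coboundaries2"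
      using defect_mem_cocycles2[OF deformation hom \<phi>0 _ low] cocycles2_subset_coboundaries2[OF trivial]
      by auto
    then obtain \<psi> where \<psi>: "module_hom scale scale \<psi>"
      "mult_defect \<mu> \<phi> (Suc n) = hoch1 \<psi>" "d_defect \<delta> \<phi> (Suc n) = (\<lambda>x. - delta1 \<psi> x)"
      by (auto simp: coboundaries2_def)
    \<comment> \<open>One \<open>\<psi>\<close> serves both defects: the update subtracts
      \<open>hoch1 \<psi>\<close> from the first and adds \<open>delta1 \<psi>\<close> to the
      second.\<close>
    define \<phi>' where "\<phi>' = \<phi>(Suc n := \<lambda>x. \<phi> (Suc n) x + \<psi> x)"
    have "mult_defect \<mu> \<phi>' (Suc n) x y = 0" "d_defect \<delta> \<phi>' (Suc n) x = 0" for x y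
      using defect_update[of \<mu> \<delta> \<phi> "Suc n" \<phi>' \<psi>, OF \<mu>0 \<delta>0 \<phi>0 _ \<phi>'_def] \<psi>(2,3)
      by simp_all
    moreover have "mult_defect \<mu> \<phi>' i = mult_defect \<mu> \<phi> i" "d_defect \<delta> \<phi>' i = d_defect \<delta> \<phi> i"
      if "i \<le> n" for i
      using that by (auto simp: \<phi>'_def intro!: defect_cong)
    moreover have "module_hom scale scale (\<phi>' i)" for i
      using hom \<psi>(1) by (simp add: \<phi>'_def self.module_hom_add)
    ultimately have "P (Suc n) \<phi>'"
      using \<phi>0 low by (auto simp: P_def \<phi>'_def le_Suc_eq)
    then show ?thesis
      by (auto simp: \<phi>'_def)
  qed
  \<comment> \<open>Each correction depends on the series chosen before it, hence dependent choice.
    Coefficient \<open>i\<close> of \<open>F n\<close> is constant from \<open>n = i\<close> on, so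
    the diagonal is the limit.\<close>
  obtain F where F: "\<And>n. P n (F n)" and F_Suc: "\<And>n i. i \<le> n \<Longrightarrow> F (Suc n) i = F n i"
    using dependent_nat_choice[of P "\<lambda>n \<phi> \<phi>'. \<forall>i\<le>n. \<phi>' i = \<phi> i", OF base step] by blast
  define \<phi> where "\<phi> i = F i i" for i
  have F_stable: "F n i = \<phi> i" if "i \<le> n" for i n
    using that by (induction n rule: dec_induct) (simp_all add: F_Suc \<phi>_def)
  have hom: "module_hom scale scale (\<phi> i)" for i
    using F by (simp add: P_def \<phi>_def)
  moreover have "\<phi> 0 = id"
    using F by (simp add: P_def \<phi>_def)
  \<comment> \<open>The defect in degree \<open>i\<close> involves only coefficients up to
    \<open>i\<close>, where the limit agrees with \<open>F i\<close>.\<close>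
  moreover have "mult_defect \<mu> \<phi> i = mult_defect \<mu> (F i) i" "d_defect \<delta> \<phi> i = d_defect \<delta> (F i) i" for i
    by (intro defect_cong; simp add: F_stable)+
  then have "mult_defect \<mu> \<phi> i x y = 0" "d_defect \<delta> \<phi> i x = 0" for i x y
    using F by (simp_all add: P_def)
  then have "fps_ext2 (mult_defect \<mu> \<phi>) x y = 0" "fps_ext (d_defect \<delta> \<phi>) x = 0" for x y
    by (simp_all add: fps_eq_iff fps_ext_nth fps_ext2_nth)
  ultimately show "trivial_deformation \<mu> \<delta>"
    unfolding trivial_deformation_def equivalent_deformations_def
    using fps_ext_mult_defect[of \<phi> \<mu>] fps_ext_d_defect[of \<phi> \<delta>] by auto
qed

end

theorem theorem5p10:
  fixes scale :: "'k::field_char_0 \<Rightarrow> 'a::ab_group_add \<Rightarrow> 'a"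
    and mult :: "'a \<Rightarrow> 'a \<Rightarrow> 'a"
    and d :: "'a \<Rightarrow> 'a"
    and weight :: 'k
  assumes "differential_algebra scale mult d weight"
    and "differential_algebra.cohomology2 scale mult d weight
           = {differential_algebra.coboundaries2 scale mult d}"
  shows "differential_algebra.rigid scale mult d weight"
  using assms by (rule differential_algebra.rigid_if_cohomology2_trivial)

end
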